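(* Let $G=(V,E)$ be a finite graph (loops and multiple edges allowed), let $d_i$ be the degree of vertex $i$, and put $\lambda_i:=1+(d_i-1)\beta$ for $i\in V$, $\boldsymbol{\lambda}=(\lambda_i)_{i\in V}$. Then $$\omega_G(\beta)=\Xi_G(-\beta,\boldsymbol{\lambda}).$$ That is, $\omega_G(\beta)=\sum_{\mathbf{D}\in\mathcal{D}}(-\beta)^{|\mathbf{D}|}\prod_{i\in V\setminus[\mathbf{D}]}\bigl(1+(d_i-1)\beta\bigr)$.
   Context: Graphs are finite undirected multigraphs; loops and multiple edges are allowed. The degree of a vertex is the number of edge-ends at it (a loop counts twice). For $s\subset E$, $d_i(s)$ is the degree of vertex $i$ in the spanning subgraph $(V,s)$. The polynomials $f_n(x)$, $n\ge 0$, are defined by $f_0(x)=1$, $f_1(x)=0$, $f_{n+1}(x)=x f_n(x)+f_{n-1}(x)$ for $n\ge1$. Put $\theta_G(\beta,\gamma):=\sum_{s\subset E}\beta^{|s|}\prod_{i\in V}f_{d_i(s)}(\gamma)$ and $$\omega_G(\beta):=\frac{\theta_G(\beta,2\sqrt{-1})}{(1-\beta)^{|E|-|V|}},$$ which is a polynomial in $\mathbb{Z}[\beta]$. A matching (dimer arrangement) of $G$ is a set $\mathbf{D}$ of edges, none of which is a loop, such that no two of them share a vertex (the empty set is a matching); $|\mathbf{D}|$ is its number of edges, $[\mathbf{D}]$ the set of vertices covered by it, and $\mathcal{D}$ the set of all matchings of $G$. The monomer-dimer partition function with edge weights $\boldsymbol{\mu}=(\mu_e)_{e\in E}$ and vertex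 weights $\boldsymbol{\lambda}=(\lambda_i)_{i\in V}$ is $\Xi_G(\boldsymbol{\mu},\boldsymbol{\lambda}):=\sum_{\mathbf{D}\in\mathcal{D}}\prod_{e\in\mathbf{D}}\mu_e\prod_{i\in V\setminus[\mathbf{D}]}\lambda_i$; one writes $\Xi_G(\mu,\boldsymbol{\lambda})$ if all $\mu_e$ equal $\mu$. *)

theory Defs
  imports
    Complex_Main
    "HOL-Library.Multiset"
    "HOL-Computational_Algebra.Computational_Algebra"
begin

text \<open>
  A finite undirected multigraph: edges are abstract labels, and \<open>ends\<close> sends an edge to the
  two-element multiset of its endpoints. Distinct labels may have the same endpoints (multiple
  edges), and a loop at \<open>v\<close> has \<open>ends e = {#v, v#}\<close>.
\<close>

record ('v, 'e) multigraph =
  verts :: "'v set"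
  edges :: "'e set"
  ends :: "'e \<Rightarrow> 'v multiset"

locale finite_multigraph =
  fixes G :: "('v, 'e) multigraph"
  assumes finite_verts: "finite (verts G)"
    and finite_edges: "finite (edges G)"
    and size_ends: "e \<in> edges G \<Longrightarrow> size (ends G e) = 2"
    and ends_in_verts: "e \<in> edges G \<Longrightarrow> set_mset (ends G e) \<subseteq> verts G"

definition is_loop :: "('v, 'e) multigraph \<Rightarrow> 'e \<Rightarrow> bool" where
  "is_loop G e \<longleftrightarrow> (\<exists>v. ends G e = {#v, v#})"

text \<open>Counting with multiplicity makes a loop contribute 2.\<close>

definition sub_degree :: "('v, 'e) multigraph \<Rightarrow> 'e set \<Rightarrow> 'v \<Rightarrow> nat" where
  "sub_degree G s i = (\<Sum>e\<in>s. count (ends G e) i)"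

definition vdegree :: "('v, 'e) multigraph \<Rightarrow> 'v \<Rightarrow> nat" where
  "vdegree G i = sub_degree G (edges G) i"

fun f_poly :: "nat \<Rightarrow> 'a::comm_semiring_1 poly" where
  "f_poly 0 = 1"
| "f_poly (Suc 0) = 0"
| "f_poly (Suc (Suc n)) = [:0, 1:] * f_poly (Suc n) + f_poly n"

text \<open>
  \<open>\<theta>\<close> and \<open>\<Xi>\<close> are defined over an arbitrary commutative ring, so that their arguments may be
  numbers as well as indeterminates.
\<close>

definition theta :: "('v, 'e) multigraph \<Rightarrow> 'a::comm_ring_1 \<Rightarrow> 'a \<Rightarrow> 'a" where
  "theta G \<beta> \<gamma> =
     (\<Sum>s\<in>Pow (edges G). \<beta> ^ card s * (\<Prod>i\<in>verts G. poly (f_poly (sub_degree G s i)) \<gamma>))"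

text \<open>
  \<open>\<omega>\<close> is the quotient taken in the field of rational functions in \<open>\<beta>\<close> over the complex numbers;
  the indeterminate \<open>\<beta>\<close> is \<open>[:0, 1:]\<close>. The exponent \<open>|E| - |V|\<close> is an integer and may be negative.
\<close>

definition omega :: "('v, 'e) multigraph \<Rightarrow> complex poly fract" where
  "omega G =
     to_fract (theta G [:0, 1:] [:2 * \<i>:])
       / to_fract (1 - [:0, 1:]) powi (int (card (edges G)) - int (card (verts G)))"

text \<open>The embedding of the integer polynomials into the rational functions over the complex numbers.\<close>

definition int_poly_to_ratfun :: "int poly \<Rightarrow> complex poly fract" where
  "int_poly_to_ratfun p = to_fract (map_poly of_int p)"

definition matchings :: "('v, 'e) multigraph \<Rightarrow> 'e set set" where
  "matchings G =
     {D. D \<subseteq> edges G \<and> (\<forall>e\<in>D. \<not> is_loop G e) \<and>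
         (\<forall>e\<in>D. \<forall>e'\<in>D. e \<noteq> e' \<longrightarrow> set_mset (ends G e) \<inter> set_mset (ends G e') = {})}"

definition covered :: "('v, 'e) multigraph \<Rightarrow> 'e set \<Rightarrow> 'v set" where
  "covered G D = (\<Union>e\<in>D. set_mset (ends G e))"

definition monomer_dimer ::
    "('v, 'e) multigraph \<Rightarrow> ('e \<Rightarrow> 'a::comm_ring_1) \<Rightarrow> ('v \<Rightarrow> 'a) \<Rightarrow> 'a" where
  "monomer_dimer G \<mu> \<Lambda> =
     (\<Sum>D\<in>matchings G. (\<Prod>e\<in>D. \<mu> e) * (\<Prod>i\<in>verts G - covered G D. \<Lambda> i))"

end

theory Submission
  imports Defs
begin

text \<open>
  At \<open>\<gamma> = 2\<i>\<close> the characteristic polynomial \<open>X\<^sup>2 - \<gamma>X - 1\<close> of the recurrence for \<open>f\<^sub>n\<close> has the double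
  root \<open>\<i>\<close>, so \<open>f\<^sub>n(2\<i>) = (1 - n) \<i>\<^sup>n\<close>. By the handshake identity the powers of \<open>\<i>\<close> at the vertices of
  a subgraph \<open>s\<close> multiply to \<open>\<i>\<close> to the power \<open>2 |s|\<close>, that is, to a sign for each edge. Hence
  \<open>\<theta>(\<beta>, 2\<i>)\<close> is the sum of \<open>(-\<beta>)\<^bsup>|s|\<^esup> \<Prod>\<^sub>i (1 - d\<^sub>i(s))\<close> over all edge sets \<open>s\<close>.

  Each factor is now affine in the degree. Replace the constants \<open>1\<close> by arbitrary vertex weights
  \<open>a\<^sub>i\<close>: then deleting an edge \<open>e\<close> from the graph relates the sum over the \<open>s\<close> containing \<open>e\<close> to the
  same kind of sum for the smaller graph, with weights \<open>a\<^sub>i\<close> lowered at the ends of \<open>e\<close>. So the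
  monomer-dimer expansion can be proved by induction on the edge set
  (\<open>weighted_subgraph_expansion\<close>). After multiplication by powers of \<open>1 - \<beta>\<close> it holds in every
  commutative ring, and the inductive step holds separately for every matching \<open>D\<close> of the smaller
  graph: it is an identity between products that differ only at the two ends of \<open>e\<close>
  (\<open>edge_exchange\<close>). When these ends are distinct and not covered by \<open>D\<close>, the products leave a
  remainder, and it is exactly the contribution of the matching \<open>D\<close> with \<open>e\<close> added.

  Setting all \<open>a\<^sub>i = 1\<close> gives the monomer weights \<open>(1 - \<beta>) + \<beta>d\<^sub>i = 1 + (d\<^sub>i - 1)\<beta>\<close>.
\<close>

section \<open>The subgraph polynomial at the double root\<close>

text \<open>
  This is the solution of the recurrence for the double characteristic root \<open>\<i>\<close>, fitted to
  \<open>f\<^sub>0 = 1\<close> and \<open>f\<^sub>1 = 0\<close>. Complex numbers appear as constant polynomials because \<open>\<beta>\<close> is an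
  indeterminate.
\<close>

lemma f_poly_at_double_root:
  "poly (f_poly n) [:2 * \<i>:] = (1 - of_nat n) * [:\<i>:] ^ n"
proof (induction n rule: f_poly.induct)
  case (3 n)
  have i2: "[:\<i>:] ^ 2 = (-1 :: complex poly)" and two: "[:2 * \<i>:] = 2 * [:\<i>:]"
    by (simp_all add: power2_eq_square one_pCons numeral_poly)
  have "poly (f_poly (Suc (Suc n))) [:2 * \<i>:]
        = 2 * [:\<i>:] * ((1 - of_nat (Suc n)) * [:\<i>:] ^ Suc n) + (1 - of_nat n) * [:\<i>:] ^ n"
    using 3 by (simp add: two del: mult_pCons_left)
  also have "\<dots> = (2 * (1 - of_nat (Suc n)) * [:\<i>:] ^ 2 + (1 - of_nat n)) * [:\<i>:] ^ n"
    by (simp add: algebra_simps power2_eq_square del: mult_pCons_left mult_pCons_right)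
  also have "\<dots> = (1 - of_nat (Suc (Suc n))) * [:\<i>:] ^ 2 * [:\<i>:] ^ n"
    unfolding i2 by (simp add: algebra_simps)
  also have "\<dots> = (1 - of_nat (Suc (Suc n))) * [:\<i>:] ^ Suc (Suc n)"
    by (simp add: power2_eq_square mult.assoc del: mult_pCons_left mult_pCons_right)
  finally show ?case .
qed simp_all

context finite_multigraph
begin

lemma handshake:
  assumes "s \<subseteq> edges G"
  shows "(\<Sum>i\<in>verts G. sub_degree G s i) = 2 * card s"
proof -
  have "(\<Sum>i\<in>verts G. sub_degree G s i) = (\<Sum>e\<in>s. \<Sum>i\<in>verts G. count (ends G e) i)"
    unfolding sub_degree_def by (rule sum.swap)
  also have "\<dots> = (\<Sum>e\<in>s. 2)"
  proof (rule sum.cong[OF refl])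
    fix e assume "e \<in> s"
    with assms have e: "e \<in> edges G" by blast
    have "(\<Sum>i\<in>verts G. count (ends G e) i) = size (ends G e)"
      unfolding size_multiset_overloaded_eq
      using finite_verts ends_in_verts[OF e]
      by (intro sum.mono_neutral_right) (auto simp: not_in_iff)
    then show "(\<Sum>i\<in>verts G. count (ends G e) i) = 2"
      using size_ends[OF e] by simp
  qed
  finally show ?thesis by simp
qed

lemma theta_at_double_root:
  fixes \<beta> :: "complex poly"
  shows "theta G \<beta> [:2 * \<i>:] =
         (\<Sum>s\<in>Pow (edges G). (- \<beta>) ^ card s * (\<Prod>i\<in>verts G. 1 - of_nat (sub_degree G s i)))"
  unfolding theta_def
proof (rule sum.cong[OF refl])
  fix s assume "s \<in> Pow (edges G)"
  then have "(\<Prod>i\<in>verts G. [:\<i>:] ^ sub_degree G s i) = ([:\<i>:] ^ 2) ^ card s"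
    by (simp add: power_sum[symmetric] handshake power_mult del: power2_eq_square)
  also have "[:\<i>:] ^ 2 = (-1 :: complex poly)"
    by (simp add: power2_eq_square one_pCons)
  finally show "\<beta> ^ card s * (\<Prod>i\<in>verts G. poly (f_poly (sub_degree G s i)) [:2 * \<i>:])
      = (- \<beta>) ^ card s * (\<Prod>i\<in>verts G. 1 - of_nat (sub_degree G s i))"
    unfolding f_poly_at_double_root prod.distrib
    by (simp add: power_minus[of \<beta>] ac_simps)
qed

end

section \<open>The effect of one edge\<close>

text \<open>
  Only the factors at \<open>x\<close> and \<open>y\<close> vary. If at most one of them varies, both sides are affine in that
  \<open>z\<close> with the same coefficients. For distinct \<open>x\<close> and \<open>y\<close> in \<open>U\<close> the terms in \<open>z\<^sub>x z\<^sub>y\<close>, \<open>z\<^sub>x\<close> and \<open>z\<^sub>y\<close>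
  still agree, but the constant terms are \<open>-\<beta>(1 - \<beta>)\<^sup>2\<close> on the left and \<open>(1 - \<beta>)\<beta>\<^sup>2\<close> on the right; the
  difference \<open>-\<beta>(1 - \<beta>)\<close> is the dimer term. For a loop, \<open>x = y\<close>, the multiset count \<open>2\<close> makes the
  affine case apply and no dimer arises.
\<close>

lemma edge_exchange:
  fixes \<beta> :: "'a::comm_ring_1"
  assumes "finite U"
  shows "(\<Prod>i\<in>U. z i) - \<beta> * (\<Prod>i\<in>U. z i - (1 - \<beta>) * of_nat (count {#x, y#} i))
    = (1 - \<beta>) * ((\<Prod>i\<in>U. z i + \<beta> * of_nat (count {#x, y#} i))
        - (if x \<noteq> y \<and> {x, y} \<subseteq> U then \<beta> * (\<Prod>i\<in>U - {x, y}. z i) else 0))"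
proof -
  have split: "(\<Prod>i\<in>U. g i) = (\<Prod>i\<in>U \<inter> {x, y}. g i) * (\<Prod>i\<in>U - {x, y}. g i)" for g :: "_ \<Rightarrow> 'a"
    using prod.Int_Diff[OF assms, of g "{x, y}"] .
  have rest: "(\<Prod>i\<in>U - {x, y}. z i + c * of_nat (count {#x, y#} i)) = (\<Prod>i\<in>U - {x, y}. z i)" for c
    by (rule prod.cong) auto
  have rest': "(\<Prod>i\<in>U - {x, y}. z i - c * of_nat (count {#x, y#} i)) = (\<Prod>i\<in>U - {x, y}. z i)" for c
    by (rule prod.cong) auto
  define R where "R = (\<Prod>i\<in>U - {x, y}. z i)"
  define A where "A = (\<Prod>i\<in>U \<inter> {x, y}. z i)"
  define B where "B = (\<Prod>i\<in>U \<inter> {x, y}. z i - (1 - \<beta>) * of_nat (count {#x, y#} i))"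
  define C where "C = (\<Prod>i\<in>U \<inter> {x, y}. z i + \<beta> * of_nat (count {#x, y#} i))"
  have core: "A - \<beta> * B = (1 - \<beta>) * (C - (if x \<noteq> y \<and> {x, y} \<subseteq> U then \<beta> else 0))"
    unfolding A_def B_def C_def
    by (cases "x = y"; cases "x \<in> U"; cases "y \<in> U")
       (auto simp: Int_insert_right algebra_simps)
  have "A * R - \<beta> * (B * R) = (A - \<beta> * B) * R"
    by (simp add: algebra_simps)
  also have "\<dots> = (1 - \<beta>) * (C * R - (if x \<noteq> y \<and> {x, y} \<subseteq> U then \<beta> * R else 0))"
    unfolding core by (auto simp: algebra_simps)
  finally show ?thesis
    unfolding split rest rest' A_def B_def C_def R_def .
qed

lemma covered_insert: "covered G (insert e D) = set_mset (ends G e) \<union> covered G D"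
  by (simp add: covered_def)

lemma matchings_insert_edge:
  fixes G :: "('v, 'e) multigraph"
  assumes "e \<notin> F"
  shows "matchings (G\<lparr>edges := insert e F\<rparr>) = matchings (G\<lparr>edges := F\<rparr>) \<union>
    insert e ` {D \<in> matchings (G\<lparr>edges := F\<rparr>).
                \<not> is_loop G e \<and> set_mset (ends G e) \<inter> covered G D = {}}"
    (is "?L = ?M \<union> insert e ` ?N")
proof (intro equalityI subsetI)
  fix D assume D: "D \<in> ?L"
  show "D \<in> ?M \<union> insert e ` ?N"
  proof (cases "e \<in> D")
    case True
    with D have "D - {e} \<in> ?N"
      by (fastforce simp: matchings_def is_loop_def covered_def)
    moreover have "D = insert e (D - {e})" using True by blast
    ultimately show ?thesis by blast
  next
    case False
    with D show ?thesis by (auto simp: matchings_def is_loop_def)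
  qed
next
  fix D assume "D \<in> ?M \<union> insert e ` ?N"
  then show "D \<in> ?L"
    by (fastforce simp: matchings_def is_loop_def covered_def)
qed

section \<open>Monomer-dimer expansion with vertex weights\<close>

text \<open>
  The vertex weights must be arbitrary for the induction on \<open>F\<close> to work: putting an edge into \<open>s\<close> raises
  the degrees at its ends, which is the same as lowering the weights there. Where
  \<open>1 - \<beta>\<close> is invertible, dividing by \<open>(1 - \<beta>)\<^bsup>|V|\<^esup>\<close> would give each dimer the weight \<open>-\<beta> / (1 - \<beta>)\<^sup>2\<close> and each free vertex
  \<open>a\<^sub>i + d\<^sub>i\<beta> / (1 - \<beta>)\<close>; since a dimer covers two vertices, clearing denominators is uniform in \<open>D\<close>.
\<close>

lemma (in finite_multigraph) weighted_subgraph_expansion: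
  fixes \<beta> :: "'a::comm_ring_1" and a :: "'v \<Rightarrow> 'a"
  assumes "F \<subseteq> edges G"
  shows "(1 - \<beta>) ^ card (verts G) *
      (\<Sum>s\<in>Pow F. (- \<beta>) ^ card s * (\<Prod>i\<in>verts G. a i - of_nat (sub_degree G s i)))
    = (1 - \<beta>) ^ card F *
      (\<Sum>D\<in>matchings (G\<lparr>edges := F\<rparr>). (- \<beta>) ^ card D *
        (\<Prod>i\<in>verts G - covered G D. (1 - \<beta>) * a i + \<beta> * of_nat (sub_degree G F i)))"
proof -
  have "finite F" using assms finite_edges finite_subset by blast
  then show ?thesis using assms
  proof (induction F arbitrary: a rule: finite_induct)
    case empty
    have "matchings (G\<lparr>edges := {}\<rparr>) = {{}}" by (auto simp: matchings_def)
    then show ?case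
      by (simp add: sub_degree_def covered_def prod.distrib)
  next
    case (insert e F)
    have e: "e \<in> edges G" and F: "F \<subseteq> edges G" using insert.prems by auto
    obtain x y where xy: "ends G e = {#x, y#}"
      using size_ends[OF e] by (metis One_nat_def Suc_1 size_1_singleton_mset size_add_mset size_eq_Suc_imp_eq_union nat.inject)
    have deg: "sub_degree G (insert e s) i = count {#x, y#} i + sub_degree G s i"
      if "s \<subseteq> F" for s i
    proof -
      have "finite s" "e \<notin> s" using that insert.hyps finite_subset by auto
      then show ?thesis by (simp add: sub_degree_def xy)
    qed
    \<comment> \<open>\<open>T\<close> and \<open>W\<close> are the summands of the two sides, \<open>z\<close> the monomer weights before \<open>e\<close> is added, and
      \<open>N\<close> the matchings that \<open>e\<close> extends.\<close>
    define c where "c i = (of_nat (count {#x, y#} i) :: 'a)" for i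
    define T where "T a s = (- \<beta>) ^ card s * (\<Prod>i\<in>verts G. a i - of_nat (sub_degree G s i))"
      for a and s
    define z where "z i = (1 - \<beta>) * a i + \<beta> * of_nat (sub_degree G F i)" for i
    let ?M = "matchings (G\<lparr>edges := F\<rparr>)"
    define N where "N = {D \<in> ?M. \<not> is_loop G e \<and> set_mset (ends G e) \<inter> covered G D = {}}"
    define W where "W D = (- \<beta>) ^ card D *
      (\<Prod>i\<in>verts G - covered G D. (1 - \<beta>) * a i + \<beta> * of_nat (sub_degree G (insert e F) i))" for D
    have finM: "finite ?M"
      by (rule finite_subset[of _ "Pow F"]) (auto simp: matchings_def insert.hyps)
    have MF: "D \<subseteq> F" if "D \<in> ?M" for D using that by (auto simp: matchings_def)
    have xyV: "{x, y} \<subseteq> verts G" using ends_in_verts[OF e] xy by auto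
    have N_iff: "D \<in> N \<longleftrightarrow> x \<noteq> y \<and> {x, y} \<subseteq> verts G - covered G D" if "D \<in> ?M" for D
      using that xyV by (auto simp: N_def is_loop_def xy add_eq_conv_ex)
    have z': "(1 - \<beta>) * (a i - c i) + \<beta> * of_nat (sub_degree G F i) = z i - (1 - \<beta>) * c i" for i
      by (simp add: z_def algebra_simps)
    have z'': "(1 - \<beta>) * a i + \<beta> * of_nat (sub_degree G (insert e F) i) = z i + \<beta> * c i" for i
      by (simp add: z_def c_def deg algebra_simps)

    have inj: "inj_on (insert e) (Pow F)"
      using insert.hyps(2) by (intro inj_onI) (metis Pow_iff insert_ident subsetD)
    \<comment> \<open>Subgraphs containing \<open>e\<close> become subgraphs of \<open>F\<close> with weights lowered by \<open>c\<close>.\<close>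
    have "(\<Sum>s\<in>Pow (insert e F). T a s) = (\<Sum>s\<in>Pow F. T a s) + (\<Sum>s\<in>Pow F. T a (insert e s))"
      using insert.hyps inj unfolding Pow_insert
      by (subst sum.union_disjoint) (auto simp: sum.reindex)
    also have "(\<Sum>s\<in>Pow F. T a (insert e s)) = - \<beta> * (\<Sum>s\<in>Pow F. T (\<lambda>i. a i - c i) s)"
      unfolding sum_distrib_left
    proof (rule sum.cong[OF refl])
      fix s assume "s \<in> Pow F"
      then have s: "s \<subseteq> F" "finite s" "e \<notin> s"
        using insert.hyps by (auto intro: finite_subset)
      then show "T a (insert e s) = - \<beta> * T (\<lambda>i. a i - c i) s"
        by (simp add: T_def deg[OF s(1)] c_def diff_diff_eq mult.assoc)
    qed
    finally have T_insert: "(\<Sum>s\<in>Pow (insert e F). T a s)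
      = (\<Sum>s\<in>Pow F. T a s) + - \<beta> * (\<Sum>s\<in>Pow F. T (\<lambda>i. a i - c i) s)" .
    have "(1 - \<beta>) ^ card (verts G) * (\<Sum>s\<in>Pow (insert e F). T a s)
      = (1 - \<beta>) ^ card (verts G) * (\<Sum>s\<in>Pow F. T a s)
        - \<beta> * ((1 - \<beta>) ^ card (verts G) * (\<Sum>s\<in>Pow F. T (\<lambda>i. a i - c i) s))"
      unfolding T_insert by (simp only: distrib_left minus_mult_left[symmetric]
          mult_minus_right mult.left_commute diff_conv_add_uminus)
    also have "\<dots> = (1 - \<beta>) ^ card F *
       (\<Sum>D\<in>?M. (- \<beta>) ^ card D * ((\<Prod>i\<in>verts G - covered G D. z i)
          - \<beta> * (\<Prod>i\<in>verts G - covered G D. z i - (1 - \<beta>) * c i)))"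
      unfolding T_def insert.IH[OF F] z' z_def[symmetric]
      by (simp add: sum_subtractf sum_distrib_left algebra_simps)
    also have "\<dots> = (1 - \<beta>) ^ card F *
       (\<Sum>D\<in>?M. (1 - \<beta>) * (W D + (if D \<in> N then W (insert e D) else 0)))"
      \<comment> \<open>Termwise in \<open>D\<close>, by exchange at the vertices that \<open>D\<close> leaves free.\<close>
    proof (rule arg_cong[where f="(*) _"], rule sum.cong[OF refl])
      fix D assume D: "D \<in> ?M"
      have "finite D" "e \<notin> D" using MF[OF D] insert.hyps finite_subset by auto
      have W_ins: "W (insert e D) = - \<beta> * (- \<beta>) ^ card D * (\<Prod>i\<in>verts G - covered G D - {x, y}. z i)"
      proof -
        have "verts G - covered G (insert e D) = verts G - covered G D - {x, y}"
          by (auto simp: covered_insert xy)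
        moreover have "(\<Prod>i\<in>verts G - covered G D - {x, y}. z i + \<beta> * c i)
            = (\<Prod>i\<in>verts G - covered G D - {x, y}. z i)"
          by (rule prod.cong) (auto simp: c_def)
        ultimately show ?thesis
          using \<open>finite D\<close> \<open>e \<notin> D\<close> by (simp add: W_def z'')
      qed
      have "finite (verts G - covered G D)" using finite_verts by simp
      note exchange = edge_exchange[OF this, of z \<beta> x y,
          folded c_def, folded N_iff[OF D]]
      show "(- \<beta>) ^ card D * ((\<Prod>i\<in>verts G - covered G D. z i)
          - \<beta> * (\<Prod>i\<in>verts G - covered G D. z i - (1 - \<beta>) * c i))
        = (1 - \<beta>) * (W D + (if D \<in> N then W (insert e D) else 0))"
        unfolding exchange W_ins unfolding W_def z''
        by (auto simp: algebra_simps)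
    qed
    also have "\<dots> = (1 - \<beta>) ^ card (insert e F) *
       (\<Sum>D\<in>?M. W D + (if D \<in> N then W (insert e D) else 0))"
      using insert.hyps by (simp add: sum_distrib_left mult.assoc mult.left_commute)
    also have "(\<Sum>D\<in>?M. W D + (if D \<in> N then W (insert e D) else 0))
        = (\<Sum>D\<in>?M. W D) + (\<Sum>D\<in>N. W (insert e D))"
      using finM by (auto simp: sum.distrib N_def sum.inter_filter)
    also have "\<dots> = (\<Sum>D\<in>matchings (G\<lparr>edges := insert e F\<rparr>). W D)"
    proof -
      have "e \<notin> D" if "D \<in> ?M" for D using MF[OF that] insert.hyps by blast
      then have "?M \<inter> insert e ` N = {}" by auto
      moreover have "inj_on (insert e) N"
        using inj by (rule inj_on_subset) (auto simp: N_def dest: MF)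
      moreover have "finite N" using finM by (simp add: N_def)
      ultimately show ?thesis
        unfolding matchings_insert_edge[OF insert.hyps(2)] N_def[symmetric]
        by (simp add: sum.union_disjoint finM sum.reindex)
    qed
    finally show ?case unfolding T_def W_def .
  qed
qed

section \<open>From integer polynomials to rational functions\<close>

abbreviation complex_coeffs :: "int poly \<Rightarrow> complex poly" where
  "complex_coeffs \<equiv> map_poly of_int"

lemma complex_coeffs_ring_hom:
  "complex_coeffs 0 = 0" "complex_coeffs 1 = 1"
  "complex_coeffs (p + q) = complex_coeffs p + complex_coeffs q"
  "complex_coeffs (- p) = - complex_coeffs p"
  "complex_coeffs (p - q) = complex_coeffs p - complex_coeffs q"
  "complex_coeffs (p * q) = complex_coeffs p * complex_coeffs q"
  "complex_coeffs (of_nat n) = of_nat n"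
  by (auto intro!: poly_eqI simp: coeff_map_poly coeff_mult of_nat_poly coeff_pCons split: nat.splits)

lemma complex_coeffs_sum: "complex_coeffs (sum f A) = (\<Sum>x\<in>A. complex_coeffs (f x))"
  by (induction A rule: infinite_finite_induct) (simp_all add: complex_coeffs_ring_hom)

lemma complex_coeffs_prod: "complex_coeffs (prod f A) = (\<Prod>x\<in>A. complex_coeffs (f x))"
  by (induction A rule: infinite_finite_induct) (simp_all add: complex_coeffs_ring_hom)

lemma complex_coeffs_power: "complex_coeffs (p ^ n) = complex_coeffs p ^ n"
  by (induction n) (simp_all add: complex_coeffs_ring_hom)

theorem theorem8:
  fixes G :: "('v, 'e) multigraph"
  assumes "finite_multigraph G"
  shows "omega G =
           int_poly_to_ratfun
             (monomer_dimer G (\<lambda>_. - [:0, 1:]) (\<lambda>i. 1 + (of_nat (vdegree G i) - 1) * [:0, 1:]))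
       \<and> omega G =
           int_poly_to_ratfun
             (\<Sum>D\<in>matchings G. (- [:0, 1:]) ^ card D *
                (\<Prod>i\<in>verts G - covered G D. 1 + (of_nat (vdegree G i) - 1) * [:0, 1:]))"
proof -
  interpret finite_multigraph G by fact
  let ?\<Xi> = "\<Sum>D\<in>matchings G. (- [:0, 1:]) ^ card D *
      (\<Prod>i\<in>verts G - covered G D. 1 + (of_nat (vdegree G i) - 1) * [:0, 1:]) :: int poly"
  define X where "X = ([:0, 1:] :: complex poly)"
  have X: "complex_coeffs [:0, 1:] = X" by (simp add: X_def map_poly_pCons)
  have \<Xi>: "complex_coeffs ?\<Xi> = (\<Sum>D\<in>matchings G. (- X) ^ card D *
      (\<Prod>i\<in>verts G - covered G D. (1 - X) * 1 + X * of_nat (sub_degree G (edges G) i)))"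
    unfolding complex_coeffs_sum complex_coeffs_prod complex_coeffs_ring_hom complex_coeffs_power X
    by (simp add: vdegree_def algebra_simps)
  have main: "(1 - X) ^ card (verts G) * theta G X [:2 * \<i>:]
      = (1 - X) ^ card (edges G) * complex_coeffs ?\<Xi>"
    using weighted_subgraph_expansion[of "edges G" X "\<lambda>_. 1"]
    unfolding theta_at_double_root \<Xi> by simp
  let ?t = "to_fract (1 - X)"
  have "1 - X \<noteq> 0" by (simp add: X_def one_pCons)
  then have t: "?t \<noteq> 0" by (simp only: to_fract_eq_0_iff not_False_eq_True)
  have to_fract_power: "to_fract (p ^ n) = to_fract p ^ n" for p :: "complex poly" and n
    by (induction n) simp_all
  have main': "?t ^ card (verts G) * to_fract (theta G X [:2 * \<i>:])
      = ?t ^ card (edges G) * to_fract (complex_coeffs ?\<Xi>)"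
    using arg_cong[OF main, of to_fract] by (simp only: to_fract_mult to_fract_power)
  have "omega G = int_poly_to_ratfun ?\<Xi>"
    unfolding omega_def int_poly_to_ratfun_def X_def[symmetric] power_int_diff[OF disjI1[OF t]]
      power_int_of_nat
    using main' t by (simp add: field_simps)
  then show ?thesis by (simp add: monomer_dimer_def)
qed

end
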